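(* Let $(X,\rho)$ be a metric space with Borel $\sigma$-algebra $\mathcal{B}$, and let $\dim:\mathcal{B}\to[0,\infty)$ be a dimensional mapping satisfying countable stability. Then the induced upper measure-dimension mapping $\dim^U$ is lower semi-continuous under the setwise topology on $\mathcal{M}(X)$; that is, if $\nu_n,\nu\in\mathcal{M}(X)$ and $\nu_n\to\nu$ setwise as $n\to\infty$, then $$\liminf_{n\to\infty}\dim^U(\nu_n)\ \geq\ \dim^U(\nu).$$
   Context: $\mathcal{M}(X)$ is the collection of all Borel measures on $(X,\mathcal{B})$ (infinite measures allowed). A dimensional mapping is a function $\dim:\mathcal{B}\to[0,\infty)$. It satisfies countable stability if $\dim(\bigcup_{i=1}^\infty A_i)=\sup_{i}\dim(A_i)$ for every countable family $\{A_i\}_{i=1}^\infty\subset\mathcal{B}$. The induced upper measure-dimension mapping is $\dim^U(\nu)=\inf\{\dim(A): A\in\mathcal{B},\ \nu(X\setminus A)=0\}$. The setwise topology on $\mathcal{M}(X)$ is the topology generated by the sets $\{\varrho\in\mathcal{M}(X): |\int_X f\,d\varrho-\int_X f\,d\nu|<\epsilon\}$ with $\nu\in\mathcal{M}(X)$, $f:X\to\mathbb{R}$ bounded measurable and $\epsilon>0$. Thus $\nu_n\to\nu$ setwise means $\int f\,d\nu_n\to\int f\,d\nu$ for every bounded measurable $f$; in particular $\nu_n(A)\to\nu(A)$ for every $A\in\mathcal{B}$. *)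

theory Defs
  imports "HOL-Analysis.Analysis"
begin

text \<open>A dimensional mapping assigns a value in \<open>[0, \<infinity>)\<close> to every Borel set.  It is a total
  function in HOL; only its values on \<open>sets borel\<close> are ever used.\<close>

definition dimensional_mapping :: "('a::topological_space set \<Rightarrow> real) \<Rightarrow> bool" where
  "dimensional_mapping \<delta> \<longleftrightarrow> (\<forall>A\<in>sets borel. 0 \<le> \<delta> A)"

text \<open>The supremum is taken in \<^typ>\<open>ereal\<close>, so that the equation also forces it to be finite;
  \<open>Sup\<close> on \<^typ>\<open>real\<close> is unspecified on unbounded sets.\<close>

definition countably_stable :: "('a::topological_space set \<Rightarrow> real) \<Rightarrow> bool" where
  "countably_stable \<delta> \<longleftrightarrow>
     (\<forall>A :: nat \<Rightarrow> 'a set. range A \<subseteq> sets borel \<longrightarrow>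
        ereal (\<delta> (\<Union>i. A i)) = (SUP i. ereal (\<delta> (A i))))"

text \<open>The collection \<open>\<M>(X)\<close>; measures may be infinite.\<close>

definition borel_measures :: "'a::topological_space measure set" where
  "borel_measures = {\<nu>. sets \<nu> = sets borel}"

text \<open>For a dimensional mapping the set below contains \<open>\<delta> UNIV\<close> and is bounded below by 0,
  so the real infimum is the genuine one.\<close>

definition upper_dim :: "('a::topological_space set \<Rightarrow> real) \<Rightarrow> 'a measure \<Rightarrow> real" where
  "upper_dim \<delta> \<nu> = Inf {\<delta> A |A. A \<in> sets borel \<and> emeasure \<nu> (UNIV - A) = 0}"

text \<open>As the measures may be infinite, the integral of a bounded measurable \<open>f\<close> is the extended
  real \<open>\<integral>f\<^sup>+ d\<nu> - \<integral>f\<^sup>- d\<nu>\<close>, defined unless both terms are infinite.  The Bochner integral would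
  not do: it is 0 whenever \<open>f\<close> is not integrable.  Note that \<^const>\<open>ennreal\<close> truncates negative
  numbers to 0.\<close>

definition has_ext_integral :: "'a measure \<Rightarrow> ('a \<Rightarrow> real) \<Rightarrow> bool" where
  "has_ext_integral \<nu> f \<longleftrightarrow>
     (\<integral>\<^sup>+x. ennreal (f x) \<partial>\<nu>) \<noteq> \<infinity> \<or> (\<integral>\<^sup>+x. ennreal (- f x) \<partial>\<nu>) \<noteq> \<infinity>"

definition ext_integral :: "'a measure \<Rightarrow> ('a \<Rightarrow> real) \<Rightarrow> ereal" where
  "ext_integral \<nu> f =
     enn2ereal (\<integral>\<^sup>+x. ennreal (f x) \<partial>\<nu>) - enn2ereal (\<integral>\<^sup>+x. ennreal (- f x) \<partial>\<nu>)"

text \<open>\<open>ereal_close \<epsilon> b a\<close> is \<open>\<bar>a - b\<bar> < \<epsilon>\<close> when \<open>b\<close> is finite; around \<open>\<plusminus>\<infinity>\<close> it is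
  the usual neighbourhood of the extended real line.\<close>

definition ereal_close :: "real \<Rightarrow> ereal \<Rightarrow> ereal \<Rightarrow> bool" where
  "ereal_close \<epsilon> b a \<longleftrightarrow>
     (if b = \<infinity> then ereal (1 / \<epsilon>) < a
      else if b = - \<infinity> then a < ereal (- (1 / \<epsilon>))
      else \<bar>a - b\<bar> < ereal \<epsilon>)"

definition setwise_nbhd :: "'a::topological_space measure \<Rightarrow> ('a \<Rightarrow> real) \<Rightarrow> real \<Rightarrow> 'a measure set"
  where
  "setwise_nbhd \<nu> f \<epsilon> =
     {\<rho> \<in> borel_measures. has_ext_integral \<rho> f \<and> ereal_close \<epsilon> (ext_integral \<nu> f) (ext_integral \<rho> f)}"

definition setwise_topology :: "'a::topological_space measure topology" where
  "setwise_topology = topology_generated_by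
     {setwise_nbhd \<nu> f \<epsilon> |\<nu> f \<epsilon>.
        \<nu> \<in> borel_measures \<and> f \<in> borel_measurable borel \<and> bounded (range f) \<and>
        has_ext_integral \<nu> f \<and> 0 < \<epsilon>}"

lemma ext_integral_integrable:
  assumes "integrable \<nu> f"
  shows "has_ext_integral \<nu> f" "ext_integral \<nu> f = ereal (integral\<^sup>L \<nu> f)"
proof -
  have f: "(\<integral>\<^sup>+x. ennreal (f x) \<partial>\<nu>) \<noteq> \<infinity>" "(\<integral>\<^sup>+x. ennreal (- f x) \<partial>\<nu>) \<noteq> \<infinity>"
    using assms by (auto simp: real_integrable_def)
  then show "has_ext_integral \<nu> f" by (simp add: has_ext_integral_def)
  from f obtain p q where "(\<integral>\<^sup>+x. ennreal (f x) \<partial>\<nu>) = ennreal p" "0 \<le> p"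
    "(\<integral>\<^sup>+x. ennreal (- f x) \<partial>\<nu>) = ennreal q" "0 \<le> q"
    by (metis ennreal_cases infinity_ennreal_def)
  then show "ext_integral \<nu> f = ereal (integral\<^sup>L \<nu> f)"
    by (simp add: ext_integral_def real_lebesgue_integral_def[OF assms] enn2ereal_ennreal)
qed

lemma ext_integral_indicator:
  assumes "A \<in> sets \<nu>"
  shows "has_ext_integral \<nu> (indicator A)" "ext_integral \<nu> (indicator A) = enn2ereal (emeasure \<nu> A)"
proof -
  have "(\<integral>\<^sup>+x. ennreal (- indicator A x) \<partial>\<nu>) = 0"
    by (simp add: ennreal_neg)
  moreover have "(\<integral>\<^sup>+x. ennreal (indicator A x) \<partial>\<nu>) = emeasure \<nu> A"
    using assms by (simp add: ennreal_indicator)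
  ultimately show "has_ext_integral \<nu> (indicator A)"
    "ext_integral \<nu> (indicator A) = enn2ereal (emeasure \<nu> A)"
    by (simp_all add: has_ext_integral_def ext_integral_def zero_ennreal.rep_eq)
qed

lemma ereal_close_refl: "0 < \<epsilon> \<Longrightarrow> ereal_close \<epsilon> b b"
  by (cases b) (auto simp: ereal_close_def)

lemma open_ereal_close: "open {a. ereal_close \<epsilon> b a}"
proof (cases b)
  case (real r)
  have "{a. ereal_close \<epsilon> b a} = {ereal (r - \<epsilon>) <..< ereal (r + \<epsilon>)}"
  proof (rule set_eqI)
    fix a show "a \<in> {a. ereal_close \<epsilon> b a} \<longleftrightarrow> a \<in> {ereal (r - \<epsilon>) <..< ereal (r + \<epsilon>)}"
      using real by (cases a) (auto simp: ereal_close_def)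
  qed
  then show ?thesis by simp
next
  case PInf
  then have "{a. ereal_close \<epsilon> b a} = {ereal (1 / \<epsilon>) <..}" by (auto simp: ereal_close_def)
  then show ?thesis by simp
next
  case MInf
  then have "{a. ereal_close \<epsilon> b a} = {..< ereal (- (1 / \<epsilon>))}" by (auto simp: ereal_close_def)
  then show ?thesis by simp
qed

lemma tendsto_ereal_close:
  assumes "\<And>\<epsilon>. 0 < \<epsilon> \<Longrightarrow> eventually (\<lambda>n. ereal_close \<epsilon> b (a n)) F"
  shows "(a \<longlongrightarrow> b) F"
proof (cases b)
  case (real r)
  show ?thesis
  proof (rule order_tendstoI)
    fix l assume "l < b"
    then obtain s where s: "l < ereal s" "s < r"
      using real ereal_dense2[of l b] by auto
    have "eventually (\<lambda>n. ereal_close (r - s) b (a n)) F" using assms s by simp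
    then show "eventually (\<lambda>n. l < a n) F"
    proof (rule eventually_mono)
      fix n assume c: "ereal_close (r - s) b (a n)"
      then have "ereal s < a n" using real by (cases "a n") (auto simp: ereal_close_def)
      then show "l < a n" using s by simp
    qed
  next
    fix l assume "b < l"
    then obtain s where s: "ereal s < l" "r < s"
      using real ereal_dense2[of b l] by auto
    have "eventually (\<lambda>n. ereal_close (s - r) b (a n)) F" using assms s by simp
    then show "eventually (\<lambda>n. a n < l) F"
    proof (rule eventually_mono)
      fix n assume c: "ereal_close (s - r) b (a n)"
      then have "a n < ereal s" using real by (cases "a n") (auto simp: ereal_close_def)
      then show "a n < l" using s by simp
    qed
  qed
next
  case PInf
  have "eventually (\<lambda>n. ereal K < a n) F" for K
  proof -
    have "eventually (\<lambda>n. ereal_close (1 / (\<bar>K\<bar> + 1)) b (a n)) F" using assms by simp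
    then show ?thesis
    proof (rule eventually_mono)
      fix n assume "ereal_close (1 / (\<bar>K\<bar> + 1)) b (a n)"
      then show "ereal K < a n" using PInf by (cases "a n") (auto simp: ereal_close_def)
    qed
  qed
  then show ?thesis using PInf by (simp add: tendsto_PInfty)
next
  case MInf
  have "eventually (\<lambda>n. a n < ereal K) F" for K
  proof -
    have "eventually (\<lambda>n. ereal_close (1 / (\<bar>K\<bar> + 1)) b (a n)) F" using assms by simp
    then show ?thesis
    proof (rule eventually_mono)
      fix n assume "ereal_close (1 / (\<bar>K\<bar> + 1)) b (a n)"
      then show "a n < ereal K" using MInf by (cases "a n") (auto simp: ereal_close_def)
    qed
  qed
  then show ?thesis using MInf by (simp add: tendsto_MInfty)
qed

lemma topspace_setwise_topology:
  "topspace setwise_topology = (borel_measures :: 'a::topological_space measure set)"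
proof -
  have self: "\<nu> \<in> setwise_nbhd \<nu> (\<lambda>_. 0) 1" "has_ext_integral \<nu> (\<lambda>_. 0)"
    if "\<nu> \<in> borel_measures" for \<nu> :: "'a measure"
    using that by (auto simp: setwise_nbhd_def has_ext_integral_def ereal_close_refl)
  then show ?thesis
    unfolding setwise_topology_def topology_generated_by_topspace
  proof (intro equalityI subsetI, goal_cases)
    case (1 \<nu>)
    then show ?case by (auto simp: setwise_nbhd_def)
  next
    case (2 \<nu>)
    have "(\<lambda>_. 0::real) \<in> borel_measurable (borel :: 'a measure)"
      "bounded (range (\<lambda>_::'a. 0::real))"
      by auto
    with self[of \<nu>] 2 show ?case using zero_less_one by blast
  qed
qed

text \<open>Convergence in the setwise topology is convergence of \<open>\<integral>f d\<nu>\<^sub>n\<close> to \<open>\<integral>f d\<nu>\<close> in the extended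
  reals.\<close>

lemma limitin_setwise_topology:
  fixes \<nu> :: "'a::topological_space measure"
  shows "limitin setwise_topology \<nu>s \<nu> F \<longleftrightarrow>
    \<nu> \<in> borel_measures \<and> (\<forall>\<^sub>F n in F. \<nu>s n \<in> borel_measures) \<and>
    (\<forall>f \<in> borel_measurable borel. bounded (range f) \<longrightarrow> has_ext_integral \<nu> f \<longrightarrow>
       (\<forall>\<^sub>F n in F. has_ext_integral (\<nu>s n) f) \<and>
       ((\<lambda>n. ext_integral (\<nu>s n) f) \<longlongrightarrow> ext_integral \<nu> f) F)"
    (is "?L \<longleftrightarrow> ?R")
proof
  assume L: ?L
  then have nu: "\<nu> \<in> borel_measures" and ev: "\<And>U. openin setwise_topology U \<Longrightarrow> \<nu> \<in> U \<Longrightarrow> \<forall>\<^sub>F n in F. \<nu>s n \<in> U"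
    by (auto simp: limitin_def topspace_setwise_topology)
  have "\<forall>\<^sub>F n in F. \<nu>s n \<in> borel_measures"
    using ev[OF openin_topspace] nu by (simp add: topspace_setwise_topology)
  moreover have "(\<forall>\<^sub>F n in F. has_ext_integral (\<nu>s n) f) \<and>
       ((\<lambda>n. ext_integral (\<nu>s n) f) \<longlongrightarrow> ext_integral \<nu> f) F"
    if f: "f \<in> borel_measurable borel" "bounded (range f)" "has_ext_integral \<nu> f" for f
  proof -
    have *: "\<forall>\<^sub>F n in F. \<nu>s n \<in> setwise_nbhd \<nu> f \<epsilon>" if "0 < \<epsilon>" for \<epsilon>
    proof (rule ev)
      show "openin setwise_topology (setwise_nbhd \<nu> f \<epsilon>)"
        unfolding setwise_topology_def using nu f that by (intro topology_generated_by_Basis) blast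
      show "\<nu> \<in> setwise_nbhd \<nu> f \<epsilon>"
        using nu f that by (simp add: setwise_nbhd_def ereal_close_refl)
    qed
    have "\<forall>\<^sub>F n in F. has_ext_integral (\<nu>s n) f"
      by (rule eventually_mono[OF *[of 1]]) (simp_all add: setwise_nbhd_def)
    moreover have "((\<lambda>n. ext_integral (\<nu>s n) f) \<longlongrightarrow> ext_integral \<nu> f) F"
      by (rule tendsto_ereal_close, rule eventually_mono[OF *]) (auto simp: setwise_nbhd_def)
    ultimately show ?thesis ..
  qed
  ultimately show ?R using nu by blast
next
  assume R: ?R
  have "\<forall>\<^sub>F n in F. \<nu>s n \<in> U" if U: "openin setwise_topology U" and "\<nu> \<in> U" for U
  proof -
    define S where "S = {setwise_nbhd \<nu> f \<epsilon> |(\<nu>::'a measure) f \<epsilon>.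
        \<nu> \<in> borel_measures \<and> f \<in> borel_measurable borel \<and> bounded (range f) \<and>
        has_ext_integral \<nu> f \<and> 0 < \<epsilon>}"
    have "generate_topology_on S U"
      using U unfolding setwise_topology_def S_def openin_topology_generated_by_iff .
    then show ?thesis using \<open>\<nu> \<in> U\<close>
    proof induction
      case Empty
      then show ?case by simp
    next
      case (Int a b)
      then show ?case by (simp add: eventually_conj)
    next
      case (UN K)
      then obtain k where "k \<in> K" "\<nu> \<in> k" by auto
      then have "\<forall>\<^sub>F n in F. \<nu>s n \<in> k" using UN by blast
      then show ?case by (rule eventually_mono) (use \<open>k \<in> K\<close> in blast)
    next
      case (Basis s)
      then obtain \<mu> f \<epsilon> where s: "s = setwise_nbhd \<mu> f \<epsilon>" "f \<in> borel_measurable borel"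
        "bounded (range f)" "0 < \<epsilon>" unfolding S_def by blast
      have c: "has_ext_integral \<nu> f" "ereal_close \<epsilon> (ext_integral \<mu> f) (ext_integral \<nu> f)"
        using Basis s by (auto simp: setwise_nbhd_def)
      have t: "((\<lambda>n. ext_integral (\<nu>s n) f) \<longlongrightarrow> ext_integral \<nu> f) F"
        and h: "\<forall>\<^sub>F n in F. has_ext_integral (\<nu>s n) f" "\<forall>\<^sub>F n in F. \<nu>s n \<in> borel_measures"
        using R s c by blast+
      have "\<forall>\<^sub>F n in F. ereal_close \<epsilon> (ext_integral \<mu> f) (ext_integral (\<nu>s n) f)"
        using topological_tendstoD[OF t open_ereal_close[of \<epsilon> "ext_integral \<mu> f"]] c by simp
      with h show ?case unfolding s setwise_nbhd_def by eventually_elim simp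
    qed
  qed
  then show ?L using R by (simp add: limitin_def topspace_setwise_topology)
qed

lemma setwise_tendsto_emeasure:
  fixes \<nu> :: "'a::topological_space measure"
  assumes "limitin setwise_topology \<nu>s \<nu> F" and A: "A \<in> sets borel"
  shows "((\<lambda>n. emeasure (\<nu>s n) A) \<longlongrightarrow> emeasure \<nu> A) F"
proof -
  have R: "\<nu> \<in> borel_measures" "\<forall>\<^sub>F n in F. \<nu>s n \<in> borel_measures"
    and *: "\<And>f. f \<in> borel_measurable borel \<Longrightarrow> bounded (range f) \<Longrightarrow> has_ext_integral \<nu> f \<Longrightarrow>
      ((\<lambda>n. ext_integral (\<nu>s n) f) \<longlongrightarrow> ext_integral \<nu> f) F"
    using assms(1) unfolding limitin_setwise_topology by blast+
  have "bounded (range (indicator A :: 'a \<Rightarrow> real))"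
    by (rule boundedI[where B = 1]) (auto simp: indicator_def)
  moreover have nu: "has_ext_integral \<nu> (indicator A)"
    "ext_integral \<nu> (indicator A) = enn2ereal (emeasure \<nu> A)"
    using R(1) A by (auto intro!: ext_integral_indicator simp: borel_measures_def)
  ultimately have "((\<lambda>n. ext_integral (\<nu>s n) (indicator A)) \<longlongrightarrow> enn2ereal (emeasure \<nu> A)) F"
    using *[of "indicator A"] A by simp
  moreover have "\<forall>\<^sub>F n in F. ext_integral (\<nu>s n) (indicator A) = enn2ereal (emeasure (\<nu>s n) A)"
    using R(2)
    by (rule eventually_mono) (use A in \<open>auto intro!: ext_integral_indicator simp: borel_measures_def\<close>)
  ultimately have "((\<lambda>n. enn2ereal (emeasure (\<nu>s n) A)) \<longlongrightarrow> enn2ereal (emeasure \<nu> A)) F"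
    by (simp add: tendsto_cong)
  then show ?thesis by simp
qed

end

theory Submission
  imports Defs
begin

text \<open>Suppose the inequality fails, and choose a real \<open>c\<close> strictly between the lower limit and the
  upper dimension of \<open>\<nu>\<close>.  Then arbitrarily late measures of the sequence have upper dimension
  below \<open>c\<close>, so each of them is carried by a Borel set of dimension below \<open>c\<close>.  The union of
  countably many such sets has dimension at most \<open>c\<close> by countable stability, and it carries all of
  these measures at once: its complement is a single Borel set that is null for arbitrarily late
  measures.  Setwise convergence evaluated on this set makes it null for \<open>\<nu>\<close>, so \<open>\<nu>\<close> has upper
  dimension at most \<open>c\<close>, a contradiction.\<close>

lemma upper_dim_le:
  assumes "dimensional_mapping \<delta>" "A \<in> sets borel" "emeasure \<nu> (UNIV - A) = 0"
  shows "upper_dim \<delta> \<nu> \<le> \<delta> A"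
  unfolding upper_dim_def
proof (rule cInf_lower)
  show "bdd_below {\<delta> A |A. A \<in> sets borel \<and> emeasure \<nu> (UNIV - A) = 0}"
    using assms(1) by (intro bdd_belowI[of _ 0]) (auto simp: dimensional_mapping_def)
qed (use assms in blast)

lemma upper_dim_lessD:
  assumes "upper_dim \<delta> \<nu> < c"
  obtains A where "A \<in> sets borel" "emeasure \<nu> (UNIV - A) = 0" "\<delta> A < c"
proof -
  have "{\<delta> A |A. A \<in> sets borel \<and> emeasure \<nu> (UNIV - A) = 0} \<noteq> {}"
    by (auto intro!: exI[of _ UNIV])
  from cInf_lessD[OF this assms[unfolded upper_dim_def]] show thesis
    using that by blast
qed

lemma countably_stable_UN_le:
  fixes A :: "nat \<Rightarrow> 'a::topological_space set"
  assumes "countably_stable \<delta>" "\<And>i. A i \<in> sets borel" "\<And>i. \<delta> (A i) \<le> c"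
  shows "\<delta> (\<Union>i. A i) \<le> c"
proof -
  have "ereal (\<delta> (\<Union>i. A i)) = (SUP i. ereal (\<delta> (A i)))"
    using assms(1,2) unfolding countably_stable_def by blast
  also have "\<dots> \<le> ereal c"
    using assms(3) by (intro SUP_least) simp
  finally show ?thesis by simp
qed

theorem theorem2p8:
  fixes \<delta> :: "'a::metric_space set \<Rightarrow> real"
    and \<nu>s :: "nat \<Rightarrow> 'a measure" and \<nu> :: "'a measure"
  assumes "dimensional_mapping \<delta>"
    and "countably_stable \<delta>"
    and "\<And>n. \<nu>s n \<in> borel_measures"
    and "\<nu> \<in> borel_measures"
    and "limitin setwise_topology \<nu>s \<nu> sequentially"
  shows "liminf (\<lambda>n. ereal (upper_dim \<delta> (\<nu>s n))) \<ge> ereal (upper_dim \<delta> \<nu>)"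
  unfolding le_Liminf_iff
proof (intro allI impI, rule ccontr)
  fix y assume y: "y < ereal (upper_dim \<delta> \<nu>)"
    and late: "\<not> (\<forall>\<^sub>F n in sequentially. y < ereal (upper_dim \<delta> (\<nu>s n)))"
  obtain c where c: "y < ereal c" "c < upper_dim \<delta> \<nu>"
    using ereal_dense2[OF y] by auto
  have "\<exists>m A. n \<le> m \<and> A \<in> sets borel \<and> emeasure (\<nu>s m) (UNIV - A) = 0 \<and> \<delta> A < c" for n
  proof -
    obtain m where m: "n \<le> m" "ereal (upper_dim \<delta> (\<nu>s m)) \<le> y"
      using late by (auto simp: eventually_sequentially not_less)
    have "ereal (upper_dim \<delta> (\<nu>s m)) < ereal c"
      using m(2) c(1) by (rule le_less_trans)
    then have "upper_dim \<delta> (\<nu>s m) < c" by simp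
    then show ?thesis by (rule upper_dim_lessD) (use m(1) in blast)
  qed
  \<comment> \<open>Any choice with \<open>n \<le> m n\<close> tends to infinity, which is all that passing to the limit along
    \<open>m\<close> requires.\<close>
  then obtain m A where m: "\<And>n. n \<le> m n" and A: "\<And>n. A n \<in> sets borel"
    and null: "\<And>n. emeasure (\<nu>s (m n)) (UNIV - A n) = 0" and dim: "\<And>n. \<delta> (A n) < c"
    by metis
  define B where "B = (\<Union>n. A n)"
  have B: "B \<in> sets borel" unfolding B_def using A by blast
  have "emeasure (\<nu>s (m n)) (UNIV - B) = 0" for n
  proof -
    have "emeasure (\<nu>s (m n)) (UNIV - B) \<le> emeasure (\<nu>s (m n)) (UNIV - A n)"
      using assms(3)[of "m n"] A[of n]
      by (intro emeasure_mono) (auto simp: B_def borel_measures_def)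
    then show ?thesis using null by simp
  qed
  moreover have "filterlim m sequentially sequentially"
    using m by (intro filterlim_at_top_mono[OF filterlim_ident]) simp
  moreover have "(\<lambda>n. emeasure (\<nu>s n) (UNIV - B)) \<longlonglongrightarrow> emeasure \<nu> (UNIV - B)"
    using setwise_tendsto_emeasure[OF assms(5), of "UNIV - B"] B by simp
  ultimately have "(\<lambda>n. 0) \<longlonglongrightarrow> emeasure \<nu> (UNIV - B)"
    using filterlim_compose[of "\<lambda>n. emeasure (\<nu>s n) (UNIV - B)" _ sequentially m sequentially]
    by simp
  then have "emeasure \<nu> (UNIV - B) = 0"
    by (simp add: LIMSEQ_const_iff)
  then have "upper_dim \<delta> \<nu> \<le> \<delta> B"
    using assms(1) B by (intro upper_dim_le)
  also have "\<delta> B \<le> c"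
    unfolding B_def by (rule countably_stable_UN_le[OF assms(2) A less_imp_le[OF dim]])
  finally show False using c(2) by simp
qed

end
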